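(* Let $G$ be a connected regular bipartite graph on $n\ge3$ vertices. The Gorenstein polytopes of the form $\operatorname{conv}(\mathcal{D}(G,\mathfrak{c}))$ with $\mathfrak{c}\in(\mathbb{Z}_{>0})^n$ are exactly $\mathcal{Q}_n'+(1,\ldots,1)$ and $\mathcal{Q}_n$.
   Context: Let $n\ge 3$ and let $G$ be a finite graph on the vertex set $V(G)=\{x_1,\ldots,x_n\}$ with no loops, no multiple edges and no isolated vertices. $G$ is regular if all its vertices have the same degree. Let $S=K[x_1,\ldots,x_n]$ be the polynomial ring over a field $K$ and let $I(G)\subset S$ be the edge ideal, generated by the monomials $x_ix_j$ with $\{x_i,x_j\}\in E(G)$. For $\mathfrak{c}=(c_1,\ldots,c_n)\in(\mathbb{Z}_{>0})^n$ and an integer $q\ge1$, $(I(G)^q)_{\mathfrak{c}}$ is the ideal generated by the monomials $x_1^{a_1}\cdots x_n^{a_n}\in I(G)^q$ with $a_i\le c_i$ for all $i$. Let $\delta_{\mathfrak{c}}(I(G))$ be the largest $q$ with $(I(G)^q)_{\mathfrak{c}}\ne(0)$, and let $\mathcal{B}(G,\mathfrak{c})$ be the minimal set of monomial generators of $(I(G)^{\delta_{\mathfrak{c}}(I(G))})_{\mathfrak{c}}$. Let $\mathcal{D}(G,\mathfrak{c})$ be the set of vectors $(a_1,\ldots,a_n)\in\mathbb{Z}_{\ge0}^n$ such that $x_1^{a_1}\cdots x_n^{a_n}$ divides some $u\in\mathcal{B}(G,\mathfrak{c})$, and let $\operatorname{conv}(\mathcal{D}(G,\mathfrak{c}))\subset\mathbb{R}^n$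 be its convex hull. A lattice polytope (all vertices in $\mathbb{Z}^n$) $\mathcal{P}\subset\mathbb{R}^n$ of dimension $n$ is reflexive if the origin lies in its interior and its dual $\mathcal{P}^\vee=\{x\in\mathbb{R}^n:\sum_i x_iy_i\le1\ \forall y\in\mathcal{P}\}$ is a lattice polytope. A lattice polytope $\mathcal{P}\subset\mathbb{R}^n$ of dimension $n$ is Gorenstein if there are an integer $\delta>0$ and $\mathbf{a}\in\mathbb{Z}^n$ such that $\delta\mathcal{P}-\mathbf{a}$ is reflexive. $\mathcal{Q}_n=[0,1]^n\subset\mathbb{R}^n$ is the standard unit cube and $\mathcal{Q}_n'=2\mathcal{Q}_n-(1,\ldots,1)=[-1,1]^n$, so $\mathcal{Q}_n'+(1,\ldots,1)=[0,2]^n$. *)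

theory Defs
  imports "HOL-Analysis.Analysis" "HOL-Library.Poly_Mapping"
begin

text \<open>
  Throughout, the vertices \<open>x\<^sub>1, \<dots>, x\<^sub>n\<close> are the elements of a finite type \<open>'n\<close>, so that
  \<open>n = CARD('n)\<close>, and a graph is given by its set of edges.
\<close>

definition simple_graph :: "'n set set \<Rightarrow> bool" where
  "simple_graph E \<longleftrightarrow> (\<forall>e\<in>E. card e = 2)"

definition no_isolated_vertices :: "'n set set \<Rightarrow> bool" where
  "no_isolated_vertices E \<longleftrightarrow> (\<forall>v. \<exists>e\<in>E. v \<in> e)"

definition connected_graph :: "'n set set \<Rightarrow> bool" where
  "connected_graph E \<longleftrightarrow> (\<forall>u v. (u, v) \<in> {(x, y). {x, y} \<in> E}\<^sup>*)"

definition vertex_degree :: "'n set set \<Rightarrow> 'n \<Rightarrow> nat" where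
  "vertex_degree E v = card {e \<in> E. v \<in> e}"

definition regular_graph :: "'n set set \<Rightarrow> bool" where
  "regular_graph E \<longleftrightarrow> (\<forall>u v. vertex_degree E u = vertex_degree E v)"

definition bipartite_graph :: "'n set set \<Rightarrow> bool" where
  "bipartite_graph E \<longleftrightarrow>
     (\<exists>A B. A \<union> B = UNIV \<and> A \<inter> B = {} \<and> (\<forall>e\<in>E. \<exists>a\<in>A. \<exists>b\<in>B. e = {a, b}))"


text \<open>
  The polynomial ring \<open>K[x\<^sub>1, \<dots>, x\<^sub>n]\<close> is the type of finitely supported maps from exponent
  vectors to \<open>K\<close>, with the convolution product.
\<close>

type_synonym ('n, 'k) mpoly = "('n \<Rightarrow>\<^sub>0 nat) \<Rightarrow>\<^sub>0 'k"

definition monomial :: "('n \<Rightarrow>\<^sub>0 nat) \<Rightarrow> ('n, 'k::field) mpoly" where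
  "monomial a = Poly_Mapping.single a 1"

definition var :: "'n \<Rightarrow> ('n, 'k::field) mpoly" where
  "var i = monomial (Poly_Mapping.single i 1)"

text \<open>The ideal generated by a set is the submodule it spans in the ring as a module over itself.\<close>

definition ideal_gen :: "'a::comm_ring_1 set \<Rightarrow> 'a set" where
  "ideal_gen B = module.span (*) B"

primrec ideal_power :: "'a::comm_ring_1 set \<Rightarrow> nat \<Rightarrow> 'a set" where
  "ideal_power I 0 = UNIV"
| "ideal_power I (Suc q) = ideal_gen {f * g | f g. f \<in> I \<and> g \<in> ideal_power I q}"

definition edge_ideal :: "'n set set \<Rightarrow> ('n, 'k::field) mpoly set" where
  "edge_ideal E = ideal_gen {var i * var j | i j. {i, j} \<in> E}"

definition bounded_part :: "('n, 'k::field) mpoly set \<Rightarrow> ('n \<Rightarrow> nat) \<Rightarrow> ('n, 'k) mpoly set" where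
  "bounded_part J c = ideal_gen {monomial a | a. monomial a \<in> J \<and> (\<forall>i. Poly_Mapping.lookup a i \<le> c i)}"

definition max_power :: "('n, 'k::field) mpoly set \<Rightarrow> ('n \<Rightarrow> nat) \<Rightarrow> nat" where
  "max_power I c = (GREATEST q. q \<ge> 1 \<and> bounded_part (ideal_power I q) c \<noteq> {0})"

definition is_min_monomial_gens :: "('n, 'k::field) mpoly set \<Rightarrow> ('n, 'k) mpoly set \<Rightarrow> bool" where
  "is_min_monomial_gens J M \<longleftrightarrow>
     M \<subseteq> range monomial \<and> ideal_gen M = J \<and> (\<forall>N. N \<subset> M \<longrightarrow> ideal_gen N \<noteq> J)"

text \<open>
  A monomial ideal has exactly one minimal set of monomial generators, so the description below
  is proper for the ideals it is applied to.
\<close>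

definition min_monomial_gens :: "('n, 'k::field) mpoly set \<Rightarrow> ('n, 'k) mpoly set" where
  "min_monomial_gens J = (THE M. is_min_monomial_gens J M)"

definition \<B> :: "'n set set \<Rightarrow> ('n \<Rightarrow> nat) \<Rightarrow> ('n, 'k::field) mpoly set" where
  "\<B> E c = (let I = edge_ideal E in
     min_monomial_gens (bounded_part (ideal_power I (max_power I c)) c))"

text \<open>
  The coefficient field is passed as a type argument, since the type of the result does not
  determine it.
\<close>

definition \<D> :: "'k::field itself \<Rightarrow> 'n::finite set set \<Rightarrow> ('n \<Rightarrow> nat) \<Rightarrow> (real ^ 'n) set" where
  "\<D> K E c = {(\<chi> i. real (Poly_Mapping.lookup a i)) | a.
     \<exists>u \<in> (\<B> E c :: ('n, 'k) mpoly set). monomial a dvd u}"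


definition lattice_polytope :: "(real ^ 'n::finite) set \<Rightarrow> bool" where
  "lattice_polytope P \<longleftrightarrow> polytope P \<and> (\<forall>v. v extreme_point_of P \<longrightarrow> (\<forall>i. v $ i \<in> \<int>))"

definition dual_body :: "(real ^ 'n::finite) set \<Rightarrow> (real ^ 'n) set" where
  "dual_body P = {x. \<forall>y\<in>P. (\<Sum>i\<in>UNIV. x $ i * y $ i) \<le> 1}"

definition reflexive_polytope :: "(real ^ 'n::finite) set \<Rightarrow> bool" where
  "reflexive_polytope P \<longleftrightarrow> lattice_polytope P \<and> aff_dim P = int CARD('n) \<and>
     0 \<in> interior P \<and> lattice_polytope (dual_body P)"

definition gorenstein_polytope :: "(real ^ 'n::finite) set \<Rightarrow> bool" where
  "gorenstein_polytope P \<longleftrightarrow> lattice_polytope P \<and> aff_dim P = int CARD('n) \<and>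
     (\<exists>(\<delta>::int) (a :: int ^ 'n). \<delta> > 0 \<and>
        reflexive_polytope ((\<lambda>x. real_of_int \<delta> *\<^sub>R x - (\<chi> i. real_of_int (a $ i))) ` P))"

definition unit_cube :: "(real ^ 'n::finite) set" where
  "unit_cube = {x. \<forall>i. 0 \<le> x $ i \<and> x $ i \<le> 1}"

definition centered_cube :: "(real ^ 'n::finite) set" where
  "centered_cube = (\<lambda>x. 2 *\<^sub>R x - (\<chi> i. 1)) ` unit_cube"

end

theory Submission
  imports Defs
begin

text \<open>
  A lattice point \<open>a\<close> lies in \<open>\<D>(G, c)\<close> iff it is dominated by the degree vector of an edge
  weighting of maximal total weight among those with degrees bounded by \<open>c\<close>. A regular bipartite
  graph has a perfect matching, and among the maximal weightings one that puts the most weight on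
  that matching has all degrees at least \<open>k\<close>, provided \<open>c \<ge> k\<close>. So \<open>conv \<D>\<close> always contains
  \<open>[0, 1]\<^sup>n\<close>, and it contains \<open>[0, 2]\<^sup>n\<close> as soon as no \<open>c\<^sub>i\<close> equals \<open>1\<close>.

  If \<open>\<delta> conv \<D> - a\<close> is reflexive, the coordinate facets force \<open>a = (1, \<dots>, 1)\<close>. By the inclusions
  above (for \<open>\<delta> \<ge> 2\<close> and for \<open>\<delta> = 1\<close>, respectively) this reflexive polytope contains \<open>[-1, 1]\<^sup>n\<close>,
  and then the integrality of the vertices of its dual forces equality.
\<close>

subsection \<open>Monomial ideals and the lattice points\<close>

text \<open>Ideals are spans in the ring viewed as a module over itself, so the span lemmas become
  available for \<open>ideal_gen\<close>.\<close>

interpretation ring_module: module "(*) :: 'a::comm_ring_1 \<Rightarrow> 'a \<Rightarrow> 'a"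
  by unfold_locales (simp_all add: algebra_simps)

text \<open>Two nested span inductions, one per factor, reduce a product of ideal elements to
  products of generators. This turns each power of the edge ideal into an ideal with explicit
  monomial generators.\<close>

lemma ideal_gen_mult_ideal_gen:
  fixes S T :: "'a::comm_ring_1 set"
  shows "ideal_gen {f * g | f g. f \<in> ideal_gen S \<and> g \<in> ideal_gen T}
       = ideal_gen {s * t | s t. s \<in> S \<and> t \<in> T}" (is "ideal_gen ?L = ideal_gen ?R")
proof -
  have 1: "s * g \<in> ring_module.span ?R" if "s \<in> S" "g \<in> ring_module.span T" for s g
    using that(2)
  proof (induction rule: ring_module.span_induct_alt)
    case base then show ?case by (simp add: ring_module.span_zero)
  next
    case (step c x y)
    have "s * x \<in> ring_module.span ?R" by (rule ring_module.span_base) (use step that in blast)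
    then have "c * (s * x) + s * y \<in> ring_module.span ?R"
      using step(2) by (rule ring_module.span_add[OF ring_module.span_scale])
    moreover have "s * (c * x + y) = c * (s * x) + s * y"
      by (simp only: distrib_left mult.left_commute)
    ultimately show ?case by simp
  qed
  have 2: "f * g \<in> ring_module.span ?R"
    if "f \<in> ring_module.span S" "g \<in> ring_module.span T" for f g
    using that(1)
  proof (induction rule: ring_module.span_induct_alt)
    case base then show ?case by (simp add: ring_module.span_zero)
  next
    case (step c x y)
    have "c * (x * g) + y * g \<in> ring_module.span ?R"
      using 1[OF step(1) that(2)] step(2) by (rule ring_module.span_add[OF ring_module.span_scale])
    moreover have "(c * x + y) * g = c * (x * g) + y * g"
      by (simp only: distrib_right mult.assoc)
    ultimately show ?case by simp
  qed
  have "?R \<subseteq> ?L" unfolding ideal_gen_def using ring_module.span_base by blast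
  moreover have "?L \<subseteq> ring_module.span ?R" unfolding ideal_gen_def using 2 by blast
  ultimately show ?thesis unfolding ideal_gen_def
    by (meson ring_module.span_minimal ring_module.span_mono ring_module.subspace_span subset_antisym)
qed

lemma monomial_mult: "monomial a * monomial b = monomial (a + b)"
  by (simp add: monomial_def mult_single)

lemma monomial_nonzero: "(monomial a :: ('n, 'k::field) mpoly) \<noteq> 0"
  unfolding monomial_def by (metis keys_single keys_zero insert_not_empty one_neq_zero)

lemma pointwise_le_imp_add:
  fixes a b :: "'n \<Rightarrow>\<^sub>0 nat"
  assumes "\<And>i. Poly_Mapping.lookup a i \<le> Poly_Mapping.lookup b i"
  shows "b = a + (b - a)"
  by (rule poly_mapping_eqI) (simp add: lookup_add lookup_minus assms)

text \<open>The polynomials all of whose exponents lie above some element of \<open>M\<close> form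
  an ideal containing the generators, hence the whole generated ideal; a single monomial in it is
  therefore divisible by a generator.\<close>

lemma monomial_in_ideal_gen_iff:
  fixes M :: "('n \<Rightarrow>\<^sub>0 nat) set"
  shows "(monomial a :: ('n, 'k::field) mpoly) \<in> ideal_gen (monomial ` M) \<longleftrightarrow>
    (\<exists>m\<in>M. \<forall>i. Poly_Mapping.lookup m i \<le> Poly_Mapping.lookup a i)"
proof
  let ?U = "{p :: ('n, 'k) mpoly. \<forall>k \<in> Poly_Mapping.keys p. \<exists>m\<in>M. \<exists>b. k = m + b}"
  assume "(monomial a :: ('n, 'k) mpoly) \<in> ideal_gen (monomial ` M)"
  moreover have "ideal_gen (monomial ` M) \<subseteq> ?U"
    unfolding ideal_gen_def
  proof (rule ring_module.span_minimal)
    show "monomial ` M \<subseteq> ?U" by (fastforce simp: monomial_def intro: exI[of _ 0])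
    show "ring_module.subspace ?U"
    proof (rule ring_module.subspaceI)
      show "0 \<in> ?U" by simp
      show "x + y \<in> ?U" if "x \<in> ?U" "y \<in> ?U" for x y
        using that keys_add[of x y] by blast
      show "c * x \<in> ?U" if x: "x \<in> ?U" for c x
      proof safe
        fix k assume "k \<in> Poly_Mapping.keys (c * x)"
        then obtain a b where "k = a + b" "b \<in> Poly_Mapping.keys x" using keys_mult[of c x] by blast
        moreover from this x obtain m b' where "m \<in> M" "b = m + b'" by blast
        ultimately show "\<exists>m\<in>M. \<exists>b. k = m + b"
          by (metis add.left_commute)
      qed
    qed
  qed
  ultimately have "(monomial a :: ('n, 'k) mpoly) \<in> ?U" by (rule rev_subsetD)
  then obtain m b where "m \<in> M" "a = m + b" by (auto simp: monomial_def)
  then show "\<exists>m\<in>M. \<forall>i. Poly_Mapping.lookup m i \<le> Poly_Mapping.lookup a i"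
    by (intro bexI[of _ m]) (simp_all add: lookup_add)
next
  assume "\<exists>m\<in>M. \<forall>i. Poly_Mapping.lookup m i \<le> Poly_Mapping.lookup a i"
  then obtain m where m: "m \<in> M" and "a = m + (a - m)"
    using pointwise_le_imp_add by metis
  then have "(monomial a :: ('n, 'k) mpoly) = monomial (a - m) * monomial m"
    by (metis monomial_mult add.commute)
  then show "(monomial a :: ('n, 'k) mpoly) \<in> ideal_gen (monomial ` M)"
    unfolding ideal_gen_def using m by (simp add: ring_module.span_base ring_module.span_scale)
qed

text \<open>Divisibility by a monomial is membership in the principal ideal that it
  generates.\<close>

lemma monomial_dvd_iff:
  "(monomial a :: ('n, 'k::field) mpoly) dvd monomial b \<longleftrightarrow>
    (\<forall>i. Poly_Mapping.lookup a i \<le> Poly_Mapping.lookup b i)"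
proof -
  have "(monomial a :: ('n, 'k) mpoly) dvd monomial b \<longleftrightarrow>
      (monomial b :: ('n, 'k) mpoly) \<in> ideal_gen (monomial ` {a})"
    by (auto simp: ideal_gen_def ring_module.span_singleton dvd_def mult.commute)
  then show ?thesis by (simp only: monomial_in_ideal_gen_iff) simp
qed

section \<open>Edge weightings and products of edges\<close>

text \<open>The degree of \<open>v\<close> in the multigraph in which each edge \<open>e\<close> has
  multiplicity \<open>w e\<close>.\<close>

definition load :: "'n set set \<Rightarrow> ('n set \<Rightarrow> nat) \<Rightarrow> 'n \<Rightarrow> nat" where
  "load E w v = (\<Sum>e | e \<in> E \<and> v \<in> e. w e)"

text \<open>The exponent vectors of products of \<open>q\<close> edges counted with multiplicity,
  that is, of the natural generators of the \<open>q\<close>-th power of the edge ideal.\<close>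

definition edge_exps :: "'n set set \<Rightarrow> nat \<Rightarrow> ('n \<Rightarrow>\<^sub>0 nat) set" where
  "edge_exps E q = {a. \<exists>w. sum w E = q \<and> (\<forall>v. Poly_Mapping.lookup a v = load E w v)}"

lemma load_fun_upd:
  fixes E :: "'n::finite set set"
  assumes "e \<in> E"
  shows "load E (w(e := w e + k)) v = load E w v + (if v \<in> e then k else 0)"
proof -
  have "load E (w(e := w e + k)) v = (\<Sum>e' | e' \<in> E \<and> v \<in> e'. w e' + (if e' = e then k else 0))"
    unfolding load_def by (rule sum.cong) auto
  also have "\<dots> = load E w v + (if v \<in> e then k else 0)"
    unfolding load_def using assms by (simp add: sum.distrib)
  finally show ?thesis .
qed

lemma sum_fun_upd:
  fixes E :: "'n::finite set set" and w :: "'n set \<Rightarrow> nat"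
  assumes "e \<in> E"
  shows "sum (w(e := w e + k)) E = sum w E + k"
proof -
  have "sum (w(e := w e + k)) E = (\<Sum>e'\<in>E. w e' + (if e' = e then k else 0))"
    by (rule sum.cong) auto
  then show ?thesis using assms by (simp add: sum.distrib)
qed

text \<open>Handshake lemma: each edge contributes its weight at both of its endpoints.\<close>

lemma sum_load:
  fixes E :: "'n::finite set set"
  assumes "simple_graph E"
  shows "(\<Sum>v\<in>UNIV. load E w v) = 2 * sum w E"
proof -
  have "(\<Sum>v\<in>UNIV. load E w v) = (\<Sum>e\<in>E. \<Sum>v | v \<in> UNIV \<and> v \<in> e. w e)"
    unfolding load_def by (rule sum.swap_restrict) auto
  also have "\<dots> = (\<Sum>e\<in>E. 2 * w e)"
    using assms by (intro sum.cong) (auto simp: simple_graph_def)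
  finally show ?thesis by (simp add: sum_distrib_left)
qed

text \<open>A weighting of positive total weight has an edge of positive weight, from which one unit
  can be taken off; conversely one unit can be put on any edge.\<close>

lemma edge_exps_Suc:
  fixes E :: "'n::finite set set"
  assumes "simple_graph E"
  shows "edge_exps E (Suc q) = {Poly_Mapping.single i 1 + Poly_Mapping.single j 1 + a | i j a.
           {i, j} \<in> E \<and> a \<in> edge_exps E q}" (is "_ = ?R")
proof (intro subset_antisym subsetI)
  fix b assume "b \<in> edge_exps E (Suc q)"
  then obtain w where w: "sum w E = Suc q" "\<And>v. Poly_Mapping.lookup b v = load E w v"
    by (auto simp: edge_exps_def)
  then obtain e where e: "e \<in> E" "w e > 0"
    by (metis gr0I sum.neutral nat.distinct(1))
  then obtain i j where ij: "e = {i, j}" "i \<noteq> j"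
    using assms by (auto simp: simple_graph_def card_2_iff)
  define w' where "w' = w(e := w e - 1)"
  \<comment> \<open>Reading \<open>w\<close> as an increase of \<open>w'\<close> makes the update
    lemmas applicable without subtraction on the natural numbers.\<close>
  have w': "w = w'(e := w' e + 1)" using e by (simp add: w'_def)
  define a where "a = b - (Poly_Mapping.single i 1 + Poly_Mapping.single j 1)"
  have l: "Poly_Mapping.lookup b v = load E w' v + (if v \<in> e then 1 else 0)" for v
    using w(2) load_fun_upd[OF e(1), of w' 1] w' by metis
  have b: "b = Poly_Mapping.single i 1 + Poly_Mapping.single j 1 + a"
    unfolding a_def
    by (rule pointwise_le_imp_add) (use l ij in \<open>auto simp: lookup_add lookup_single when_def\<close>)
  have "Poly_Mapping.lookup a v = load E w' v" for v
    using l[of v] ij unfolding b by (auto simp: lookup_add lookup_single when_def split: if_splits)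
  moreover have "sum w' E = q" using sum_fun_upd[OF e(1), of w' 1] w' w(1) by simp
  ultimately have "a \<in> edge_exps E q" unfolding edge_exps_def by blast
  then show "b \<in> ?R" using b e(1) ij by blast
next
  fix b assume "b \<in> ?R"
  then obtain i j a w where *: "b = Poly_Mapping.single i 1 + Poly_Mapping.single j 1 + a"
    "{i, j} \<in> E" "sum w E = q" "\<And>v. Poly_Mapping.lookup a v = load E w v"
    by (auto simp: edge_exps_def)
  have "i \<noteq> j" using *(2) assms by (fastforce simp: simple_graph_def)
  then have "Poly_Mapping.lookup b v = load E (w({i, j} := w {i, j} + 1)) v" for v
    unfolding load_fun_upd[OF *(2)] using * by (auto simp: lookup_add lookup_single when_def)
  moreover have "sum (w({i, j} := w {i, j} + 1)) E = Suc q"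
    using sum_fun_upd[OF *(2), of w 1] *(3) by simp
  ultimately show "b \<in> edge_exps E (Suc q)" unfolding edge_exps_def by blast
qed

lemma ideal_power_edge_ideal:
  fixes E :: "'n::finite set set"
  assumes "simple_graph E"
  shows "ideal_power (edge_ideal E) q
       = (ideal_gen (monomial ` edge_exps E q) :: ('n, 'k::field) mpoly set)"
proof (induction q)
  case 0
  have "0 \<in> edge_exps E 0"
    unfolding edge_exps_def by (auto simp: load_def intro!: exI[of _ "\<lambda>_. 0"])
  then have "1 \<in> (ideal_gen (monomial ` edge_exps E 0) :: ('n, 'k) mpoly set)"
    unfolding ideal_gen_def
    by (intro ring_module.span_base) (auto simp: monomial_def intro!: image_eqI[of _ _ 0])
  then have "x \<in> (ideal_gen (monomial ` edge_exps E 0) :: ('n, 'k) mpoly set)" for x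
    unfolding ideal_gen_def using ring_module.span_scale[of 1 _ x] by simp
  then show ?case by auto
next
  case (Suc q)
  have "{s * t | s t. s \<in> {var i * var j | i j. {i, j} \<in> E} \<and> t \<in> monomial ` edge_exps E q}
      = (monomial ` edge_exps E (Suc q) :: ('n, 'k) mpoly set)"
    unfolding edge_exps_Suc[OF assms]
    by (auto simp: var_def monomial_mult image_iff add.assoc) (metis monomial_mult add.assoc)+
  then show ?case
    unfolding ideal_power.simps Suc unfolding edge_ideal_def ideal_gen_mult_ideal_gen
    by (rule arg_cong)
qed

text \<open>A monomial of the power with exponents bounded by \<open>c\<close> is a multiple of some
  generator, and the exponents of that generator are then bounded by \<open>c\<close> as
  well.\<close>

lemma bounded_part_ideal_power:
  fixes E :: "'n::finite set set"
  assumes "simple_graph E"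
  shows "bounded_part (ideal_power (edge_ideal E) q) c
       = (ideal_gen (monomial ` {a \<in> edge_exps E q. \<forall>i. Poly_Mapping.lookup a i \<le> c i})
           :: ('n, 'k::field) mpoly set)" (is "?L = ideal_gen ?R")
proof (intro subset_antisym)
  show "?L \<subseteq> ideal_gen ?R"
    unfolding bounded_part_def
    unfolding ideal_gen_def[of "{monomial a | a. monomial a \<in> ideal_power (edge_ideal E) q \<and>
        (\<forall>i. Poly_Mapping.lookup a i \<le> c i)}"]
  proof (rule ring_module.span_minimal)
    show "{monomial a |a. monomial a \<in> (ideal_power (edge_ideal E) q :: ('n, 'k) mpoly set) \<and>
        (\<forall>i. Poly_Mapping.lookup a i \<le> c i)} \<subseteq> ideal_gen ?R"
      by (auto simp: ideal_power_edge_ideal[OF assms] monomial_in_ideal_gen_iff) (meson order_trans)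
  qed (simp add: ideal_gen_def)
  show "ideal_gen ?R \<subseteq> ?L"
    unfolding bounded_part_def unfolding ideal_gen_def
    by (rule ring_module.span_mono)
      (auto simp: ideal_power_edge_ideal[OF assms] monomial_in_ideal_gen_iff)
qed

section \<open>Minimal generators and the maximal power\<close>

lemma min_monomial_gens_antichain:
  fixes A :: "('n \<Rightarrow>\<^sub>0 nat) set"
  assumes antichain: "\<And>a b. \<lbrakk>a \<in> A; b \<in> A; \<forall>i. Poly_Mapping.lookup a i \<le> Poly_Mapping.lookup b i\<rbrakk> \<Longrightarrow> a = b"
  shows "min_monomial_gens (ideal_gen (monomial ` A)) = (monomial ` A :: ('n, 'k::field) mpoly set)"
  unfolding min_monomial_gens_def
proof (rule the_equality)
  show "is_min_monomial_gens (ideal_gen (monomial ` A)) (monomial ` A :: ('n, 'k) mpoly set)"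
    unfolding is_min_monomial_gens_def
  proof (intro conjI allI impI notI)
    fix N assume N: "N \<subset> (monomial ` A :: ('n, 'k) mpoly set)"
      and eq: "ideal_gen N = (ideal_gen (monomial ` A) :: ('n, 'k) mpoly set)"
    obtain N' where N': "N' \<subseteq> A" "N = monomial ` N'" using N by (meson psubset_imp_subset subset_imageE)
    obtain a where a: "a \<in> A" "monomial a \<notin> N" using N by blast
    have "(monomial a :: ('n, 'k) mpoly) \<in> ideal_gen N"
      unfolding eq monomial_in_ideal_gen_iff using a by blast
    then obtain m where "m \<in> N'" "\<forall>i. Poly_Mapping.lookup m i \<le> Poly_Mapping.lookup a i"
      unfolding N' monomial_in_ideal_gen_iff by blast
    then show False using a N' antichain by blast
  qed auto
next
  fix M assume M: "is_min_monomial_gens (ideal_gen (monomial ` A)) (M :: ('n, 'k) mpoly set)"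
  then obtain A' where A': "M = monomial ` A'" unfolding is_min_monomial_gens_def
    by (meson subset_imageE)
  have gen: "ideal_gen (monomial ` A') = (ideal_gen (monomial ` A) :: ('n, 'k) mpoly set)"
    using M A' by (simp add: is_min_monomial_gens_def)
  have "a \<in> A'" if "a \<in> A" for a
  proof -
    have "(monomial a :: ('n, 'k) mpoly) \<in> ideal_gen (monomial ` A')"
      unfolding gen monomial_in_ideal_gen_iff using that by blast
    then obtain a' where a': "a' \<in> A'" "\<forall>i. Poly_Mapping.lookup a' i \<le> Poly_Mapping.lookup a i"
      unfolding monomial_in_ideal_gen_iff by blast
    have "(monomial a' :: ('n, 'k) mpoly) \<in> ideal_gen (monomial ` A)"
      unfolding gen[symmetric] monomial_in_ideal_gen_iff using a' by blast
    then obtain b where b: "b \<in> A" "\<forall>i. Poly_Mapping.lookup b i \<le> Poly_Mapping.lookup a' i"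
      unfolding monomial_in_ideal_gen_iff by blast
    have "b = a" using b a' that by (intro antichain) (auto intro: order_trans)
    then have "a' = a" using a' b by (intro poly_mapping_eqI antisym) auto
    then show ?thesis using a' by simp
  qed
  then have "monomial ` A \<subseteq> M" using A' by blast
  then show "M = monomial ` A" using M unfolding is_min_monomial_gens_def by blast
qed

definition max_load_size :: "'n set set \<Rightarrow> ('n \<Rightarrow> nat) \<Rightarrow> nat" where
  "max_load_size E c = (GREATEST q. \<exists>w. sum w E = q \<and> (\<forall>v. load E w v \<le> c v))"

text \<open>A crude bound from the handshake lemma, which ensures that the greatest total weight
  exists.\<close>

lemma sum_le_sum_bounds:
  fixes E :: "'n::finite set set"
  assumes "simple_graph E" "\<forall>v. load E w v \<le> c v"
  shows "sum w E \<le> sum c UNIV"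
  using sum_load[OF assms(1), of w] sum_mono[of UNIV "load E w" c] assms(2) by simp

lemma max_power_edge_ideal:
  fixes E :: "'n::finite set set"
  assumes "simple_graph E" "E \<noteq> {}" "\<forall>v. c v > 0"
  shows "max_power (edge_ideal E :: ('n, 'k::field) mpoly set) c = max_load_size E c"
proof -
  define Q where "Q q \<longleftrightarrow> (\<exists>w. sum w E = q \<and> (\<forall>v. load E w v \<le> c v))" for q
  have ne: "ideal_gen (monomial ` A) \<noteq> ({0} :: ('n, 'k) mpoly set) \<longleftrightarrow> A \<noteq> {}" for A
  proof
    assume "A \<noteq> {}"
    then obtain a where "a \<in> A" by blast
    then have "(monomial a :: ('n, 'k) mpoly) \<in> ideal_gen (monomial ` A)"
      unfolding monomial_in_ideal_gen_iff by blast
    then show "ideal_gen (monomial ` A) \<noteq> ({0} :: ('n, 'k) mpoly set)" using monomial_nonzero by auto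
  qed (auto simp: ideal_gen_def)
  have Q: "bounded_part (ideal_power (edge_ideal E :: ('n, 'k) mpoly set) q) c \<noteq> {0} \<longleftrightarrow> Q q" for q
  proof -
    have "a \<in> edge_exps E q \<Longrightarrow> \<forall>i. Poly_Mapping.lookup a i \<le> c i \<Longrightarrow> Q q" for a
      unfolding edge_exps_def Q_def by auto
    moreover have "\<exists>a\<in>edge_exps E q. \<forall>i. Poly_Mapping.lookup a i \<le> c i" if q: "Q q"
    proof -
      obtain w where w: "sum w E = q" "\<forall>v. load E w v \<le> c v" using q Q_def by auto
      \<comment> \<open>Over the finite type of vertices every function has finite support, so each
        load function is an exponent vector.\<close>
      have "Poly_Mapping.lookup (Abs_poly_mapping (load E w)) v = load E w v" for v
        by (simp add: Abs_poly_mapping_inverse)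
      then show ?thesis using w unfolding edge_exps_def
        by (intro bexI[of _ "Abs_poly_mapping (load E w)"]) auto
    qed
    ultimately show ?thesis unfolding bounded_part_ideal_power[OF assms(1)] ne by blast
  qed
  obtain e where e: "e \<in> E" using assms by blast
  \<comment> \<open>A single edge of weight 1 has loads at most 1, hence respects any positive
    bound; this puts the maximum in the range \<open>q \<ge> 1\<close> used by
    \<open>max_power\<close>.\<close>
  have one: "Q 1" unfolding Q_def
  proof (intro exI conjI allI)
    show "sum ((\<lambda>_. 0)(e := 0 + 1)) E = (1::nat)" using sum_fun_upd[OF e, of "\<lambda>_. 0" 1] by simp
    show "load E ((\<lambda>_. 0)(e := 0 + 1)) v \<le> c v" for v
      using load_fun_upd[OF e, of "\<lambda>_. 0" 1 v] assms(3)[rule_format, of v] by (simp add: load_def)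
  qed
  have bd: "Q q \<Longrightarrow> q \<le> sum c UNIV" for q
    unfolding Q_def using sum_le_sum_bounds[OF assms(1)] by blast
  have G: "Q (Greatest Q)" by (rule GreatestI_nat[of Q, OF one]) (use bd in auto)
  have G1: "1 \<le> Greatest Q" by (rule Greatest_le_nat[of Q, OF one]) (use bd in auto)
  have "(GREATEST q. q \<ge> 1 \<and> Q q) = Greatest Q"
    by (rule Greatest_equality) (use G G1 bd in \<open>auto intro: Greatest_le_nat[of Q]\<close>)
  then show ?thesis unfolding max_power_def Q by (simp add: max_load_size_def Q_def[abs_def])
qed

text \<open>All bounded generators of the top power have the same total degree, twice the maximal
  weight, so comparable ones coincide. They form an antichain and are exactly the minimal
  generators; divisors of monomials are then componentwise smaller exponent vectors.\<close>

lemma \<D>_eq: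
  fixes E :: "'n::finite set set"
  assumes "simple_graph E" "E \<noteq> {}" "\<forall>v. c v > 0"
  shows "\<D> TYPE('k::field) E c = {(\<chi> i. real (a i)) | a. \<exists>w. sum w E = max_load_size E c \<and>
           (\<forall>v. a v \<le> load E w v \<and> load E w v \<le> c v)}"
proof -
  let ?A = "{a \<in> edge_exps E (max_load_size E c). \<forall>i. Poly_Mapping.lookup a i \<le> c i}"
  have deg: "(\<Sum>v\<in>UNIV. Poly_Mapping.lookup a v) = 2 * q" if "a \<in> edge_exps E q" for a q
    using that sum_load[OF assms(1)] unfolding edge_exps_def by auto
  have "a = b" if "a \<in> ?A" "b \<in> ?A" "\<forall>i. Poly_Mapping.lookup a i \<le> Poly_Mapping.lookup b i" for a b
  proof (rule poly_mapping_eqI, rule ccontr)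
    fix i assume "Poly_Mapping.lookup a i \<noteq> Poly_Mapping.lookup b i"
    then have "(\<Sum>v\<in>UNIV. Poly_Mapping.lookup a v) < (\<Sum>v\<in>UNIV. Poly_Mapping.lookup b v)"
      using that(3) by (intro sum_strict_mono_ex1) (auto intro: le_neq_implies_less)
    moreover have "a \<in> edge_exps E (max_load_size E c)" "b \<in> edge_exps E (max_load_size E c)"
      using that by blast+
    ultimately show False by (simp add: deg)
  qed
  from min_monomial_gens_antichain[OF this]
  have B: "\<B> E c = (monomial ` ?A :: ('n, 'k) mpoly set)"
    unfolding \<B>_def Let_def max_power_edge_ideal[OF assms] bounded_part_ideal_power[OF assms(1)]
    by blast
  show ?thesis (is "_ = ?R")
  proof (intro subset_antisym subsetI)
    fix x assume "x \<in> \<D> TYPE('k::field) E c"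
    then obtain a u where "x = (\<chi> i. real (Poly_Mapping.lookup a i))" "u \<in> ?A"
      "\<forall>i. Poly_Mapping.lookup a i \<le> Poly_Mapping.lookup u i"
      unfolding \<D>_def B by (auto simp: monomial_dvd_iff)
    then show "x \<in> ?R" unfolding edge_exps_def by fastforce
  next
    fix x assume "x \<in> ?R"
    then obtain a w where x: "x = (\<chi> i. real (a i))" and w: "sum w E = max_load_size E c"
      "\<forall>v. a v \<le> load E w v \<and> load E w v \<le> c v" by blast
    have l: "Poly_Mapping.lookup (Abs_poly_mapping f) = f" for f :: "'n \<Rightarrow> nat"
      by (simp add: Abs_poly_mapping_inverse)
    have "Abs_poly_mapping (load E w) \<in> ?A" using w by (auto simp: edge_exps_def l)
    moreover have "(monomial (Abs_poly_mapping a) :: ('n, 'k) mpoly) dvd monomial (Abs_poly_mapping (load E w))"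
      using w by (simp add: monomial_dvd_iff l)
    ultimately show "x \<in> \<D> TYPE('k::field) E c"
      unfolding \<D>_def B x by (fastforce simp: l intro!: exI[of _ "Abs_poly_mapping a"])
  qed
qed

subsection \<open>Matchings\<close>

text \<open>
  Rado's argument: if some \<open>f a\<close> has two elements, one of them can be deleted without violating
  Hall's condition; otherwise two violating sets contradict the condition for their union and
  intersection.
\<close>

lemma hall:
  assumes "finite A" "\<And>a. a \<in> A \<Longrightarrow> finite (f a)"
    and "\<And>X. X \<subseteq> A \<Longrightarrow> card X \<le> card (\<Union>(f ` X))"
  shows "\<exists>g. inj_on g A \<and> (\<forall>a\<in>A. g a \<in> f a)"
  using assms(2-)
proof (induction "\<Sum>a\<in>A. card (f a)" arbitrary: f rule: less_induct)
  case (less f)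
  have pos: "card (f a) \<ge> 1" if "a \<in> A" for a
    using less.prems(2)[of "{a}"] that by simp
  show ?case
  proof (cases "\<exists>a\<in>A. card (f a) \<noteq> 1")
    case False
    then have s: "f a = {the_elem (f a)}" if "a \<in> A" for a
      using that by (metis card_1_singletonE the_elem_eq)
    have "inj_on (\<lambda>a. the_elem (f a)) A"
    proof (rule inj_onI, rule ccontr)
      fix a b assume ab: "a \<in> A" "b \<in> A" "the_elem (f a) = the_elem (f b)" "a \<noteq> b"
      then have "\<Union>(f ` {a, b}) = {the_elem (f a)}" using s[OF ab(1)] s[OF ab(2)] by simp
      then show False using less.prems(2)[of "{a, b}"] ab by simp
    qed
    then show ?thesis using s by blast
  next
    case True
    then obtain a where a: "a \<in> A" "card (f a) \<noteq> 1" by blast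
    then have "\<not> card (f a) \<le> Suc 0" using pos[OF a(1)] by simp
    then obtain x y where xy: "x \<in> f a" "y \<in> f a" "x \<noteq> y"
      using card_le_Suc0_iff_eq[OF less.prems(1)[OF a(1)]] by blast
    have shrink: ?thesis
      if "z \<in> f a" and hall: "\<And>X. X \<subseteq> A \<Longrightarrow> card X \<le> card (\<Union>((f(a := f a - {z})) ` X))" for z
    proof -
      have "(\<Sum>b\<in>A. card ((f(a := f a - {z})) b)) < (\<Sum>b\<in>A. card (f b))"
      proof (rule sum_strict_mono_ex1[OF assms(1)])
        show "\<forall>b\<in>A. card ((f(a := f a - {z})) b) \<le> card (f b)"
          by (simp add: card_Diff1_le)
        show "\<exists>b\<in>A. card ((f(a := f a - {z})) b) < card (f b)"
          using a(1) that(1) less.prems(1)[OF a(1)] by (intro bexI[of _ a]) (simp_all only: fun_upd_same card_Diff1_less)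
      qed
      moreover have "finite ((f(a := f a - {z})) b)" if "b \<in> A" for b
        using less.prems(1) a(1) that by simp
      ultimately obtain g where "inj_on g A" "\<forall>b\<in>A. g b \<in> (f(a := f a - {z})) b"
        using less.hyps hall by blast
      then show ?thesis by (metis DiffD1 fun_upd_apply)
    qed
    have viol: "\<exists>X. X \<subseteq> A \<and> a \<notin> X \<and> card (\<Union>(f ` X) \<union> (f a - {z})) \<le> card X"
      if z: "z \<in> f a" and no: "\<not> ?thesis" for z
    proof -
      obtain X where X: "X \<subseteq> A" "card (\<Union>((f(a := f a - {z})) ` X)) < card X"
        using shrink[OF z] no by (meson not_le)
      have "a \<in> X"
      proof (rule ccontr)
        assume "a \<notin> X"
        then have "(f(a := f a - {z})) ` X = f ` X" by auto
        then show False using X less.prems(2)[OF X(1)] by simp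
      qed
      moreover from this have "\<Union>((f(a := f a - {z})) ` X) = \<Union>(f ` (X - {a})) \<union> (f a - {z})"
        by auto
      moreover have "card X = Suc (card (X - {a}))"
        using finite_subset[OF X(1) assms(1)] \<open>a \<in> X\<close> by (rule card.remove)
      ultimately show ?thesis using X by (intro exI[of _ "X - {a}"]) auto
    qed
    show ?thesis
    proof (rule ccontr)
      assume no: "\<not> ?thesis"
      obtain X where X: "X \<subseteq> A" "a \<notin> X" "card (\<Union>(f ` X) \<union> (f a - {x})) \<le> card X"
        using viol[OF xy(1) no] by blast
      obtain Y where Y: "Y \<subseteq> A" "a \<notin> Y" "card (\<Union>(f ` Y) \<union> (f a - {y})) \<le> card Y"
        using viol[OF xy(2) no] by blast
      define P Q where "P = \<Union>(f ` X) \<union> (f a - {x})" and "Q = \<Union>(f ` Y) \<union> (f a - {y})"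
      have finXY: "finite X" "finite Y" using X(1) Y(1) assms(1) by (auto intro: finite_subset)
      then have fin: "finite X" "finite Y" "finite P" "finite Q"
        using X(1) Y(1) less.prems(1) a(1) unfolding P_def Q_def by blast+
      \<comment> \<open>As \<open>x\<close> and \<open>y\<close> differ, the two truncated copies of
        \<open>f a\<close> together cover all of \<open>f a\<close>.\<close>
      have "P \<union> Q = \<Union>(f ` insert a (X \<union> Y))" using xy unfolding P_def Q_def by auto
      then have "card (P \<union> Q) = card (\<Union>(f ` insert a (X \<union> Y)))" by (rule arg_cong)
      moreover have "card (insert a (X \<union> Y)) \<le> card (\<Union>(f ` insert a (X \<union> Y)))"
        by (rule less.prems(2)) (use X Y a in auto)
      moreover have "card (X \<inter> Y) \<le> card (\<Union>(f ` (X \<inter> Y)))"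
        by (rule less.prems(2)) (use X Y a in auto)
      moreover have "card (\<Union>(f ` (X \<inter> Y))) \<le> card (P \<inter> Q)"
        by (rule card_mono) (use fin in \<open>auto simp: P_def Q_def\<close>)
      moreover have "card (insert a (X \<union> Y)) = Suc (card (X \<union> Y))" using X Y fin by simp
      ultimately have "Suc (card X + card Y) \<le> card P + card Q"
        using card_Un_Int[OF fin(1,2)] card_Un_Int[OF fin(3,4)] by linarith
      then show False using X(3) Y(3) unfolding P_def Q_def by linarith
    qed
  qed
qed

section \<open>Perfect matchings of regular bipartite graphs\<close>

lemma sum_vertex_degree:
  fixes E :: "'n::finite set set"
  shows "(\<Sum>v\<in>X. vertex_degree E v) = (\<Sum>e\<in>E. card (e \<inter> X))"
proof -
  have "(\<Sum>v\<in>X. vertex_degree E v) = (\<Sum>v\<in>X. \<Sum>e | e \<in> E \<and> v \<in> e. 1)"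
    by (simp add: vertex_degree_def)
  also have "\<dots> = (\<Sum>e\<in>E. \<Sum>v | v \<in> X \<and> v \<in> e. 1)" by (rule sum.swap_restrict) auto
  also have "\<dots> = (\<Sum>e\<in>E. card (e \<inter> X))"
    by (auto intro!: sum.cong arg_cong[of _ _ card])
  finally show ?thesis .
qed

text \<open>With common degree \<open>d > 0\<close>, the edges meeting a subset \<open>X\<close> of
  \<open>A\<close> number \<open>d * card X\<close>, and each of them also meets the neighbourhood
  of \<open>X\<close>, which gives Hall's condition. Counting all edges from either side gives
  \<open>card A = card B\<close>, so an injective choice is a bijection.\<close>

lemma regular_bipartite_perfect_matching:
  fixes E :: "'n::finite set set"
  assumes "no_isolated_vertices E" "regular_graph E" "bipartite_graph E"
  obtains m where "m \<subseteq> E" "\<And>v. \<exists>!e. e \<in> m \<and> v \<in> e"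
proof -
  obtain A B where AB: "A \<union> B = UNIV" "A \<inter> B = {}" "\<And>e. e \<in> E \<Longrightarrow> \<exists>a\<in>A. \<exists>b\<in>B. e = {a, b}"
    using assms(3) by (metis bipartite_graph_def)
  define d where "d = vertex_degree E undefined"
  have d: "vertex_degree E v = d" for v
    using assms(2) unfolding d_def regular_graph_def by blast
  have "d > 0"
    using assms(1) unfolding d_def no_isolated_vertices_def vertex_degree_def by (auto simp: card_gt_0_iff)
  have cnt: "d * card X = (\<Sum>e\<in>E. card (e \<inter> X))" for X
    using sum_vertex_degree[of E X] by (simp add: d mult.commute)
  have one: "card (e \<inter> A) = 1" "card (e \<inter> B) = 1" if "e \<in> E" for e
  proof -
    obtain a b where e: "a \<in> A" "b \<in> B" "e = {a, b}" using AB(3)[OF \<open>e \<in> E\<close>] by blast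
    then have "e \<inter> A = {a}" "e \<inter> B = {b}" using AB(2) by auto
    then show "card (e \<inter> A) = 1" "card (e \<inter> B) = 1" by simp_all
  qed
  have "d * card A = d * card B" by (simp add: cnt one)
  then have cAB: "card A = card B" using \<open>d > 0\<close> by simp
  define f where "f a = {b \<in> B. {a, b} \<in> E}" for a
  have "card X \<le> card (\<Union>(f ` X))" if X: "X \<subseteq> A" for X
  proof -
    have "card (e \<inter> X) \<le> card (e \<inter> \<Union>(f ` X))" if "e \<in> E" for e
    proof (cases "e \<inter> X = {}")
      case False
      obtain a b where e: "a \<in> A" "b \<in> B" "e = {a, b}" using AB(3)[OF \<open>e \<in> E\<close>] by blast
      have "card (e \<inter> X) \<le> card (e \<inter> A)" by (rule card_mono) (use X in auto)
      moreover have "b \<in> e \<inter> \<Union>(f ` X)" using e False X AB(2) that by (auto simp: f_def)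
      then have "card (e \<inter> \<Union>(f ` X)) \<ge> 1"
        by (metis One_nat_def Suc_leI card_gt_0_iff empty_iff finite)
      ultimately show ?thesis using one(1)[OF that] by simp
    qed simp
    then have "d * card X \<le> d * card (\<Union>(f ` X))" unfolding cnt by (rule sum_mono)
    then show ?thesis using \<open>d > 0\<close> by simp
  qed
  then obtain g where g: "inj_on g A" "\<forall>a\<in>A. g a \<in> f a" using hall[of A f] by auto
  have "g ` A \<subseteq> B" using g(2) by (auto simp: f_def)
  then have gA: "g ` A = B" using cAB card_image[OF g(1)] by (intro card_subset_eq) auto
  define m where "m = (\<lambda>a. {a, g a}) ` A"
  show thesis
  proof (rule that)
    show "m \<subseteq> E" using g(2) by (auto simp: m_def f_def)
    show "\<exists>!e. e \<in> m \<and> v \<in> e" for v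
    proof (cases "v \<in> A")
      case True
      have "e = {v, g v}" if "e \<in> m" "v \<in> e" for e
        using that True \<open>g ` A \<subseteq> B\<close> AB(2) by (auto simp: m_def)
      then show ?thesis using True by (auto simp: m_def)
    next
      case False
      then obtain a where a: "a \<in> A" "v = g a" using gA AB(1) by blast
      have "e = {a, g a}" if "e \<in> m" "v \<in> e" for e
        using that a False g(1) by (auto simp: m_def dest: inj_onD)
      moreover have "{a, g a} \<in> m" using a(1) by (simp add: m_def)
      ultimately show ?thesis using a(2) by blast
    qed
  qed
qed

section \<open>Edge weightings of maximal total weight\<close>

lemma max_load_attained:
  fixes E :: "'n::finite set set"
  assumes "simple_graph E"
  obtains w where "sum w E = max_load_size E c" "\<And>v. load E w v \<le> c v"
proof -
  let ?Q = "\<lambda>q. \<exists>w. sum w E = q \<and> (\<forall>v. load E w v \<le> c v)"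
  have "?Q 0" by (intro exI[of _ "\<lambda>_. 0"]) (simp add: load_def)
  then have "?Q (Greatest ?Q)"
    by (rule GreatestI_nat[where b = "sum c UNIV"]) (use sum_le_sum_bounds[OF assms] in blast)
  then show thesis using that unfolding max_load_size_def by blast
qed

lemma sum_le_max_load_size:
  fixes E :: "'n::finite set set"
  assumes "simple_graph E" "\<And>v. load E w v \<le> c v"
  shows "sum w E \<le> max_load_size E c"
  unfolding max_load_size_def
  by (rule Greatest_le_nat[where b = "sum c UNIV"]) (use sum_le_sum_bounds assms in blast)+

text \<open>
  If \<open>v\<close> has degree below \<open>k\<close>, its matching edge can be added, or, when the partner of \<open>v\<close> is
  already saturated, exchanged for another edge at the partner. The first contradicts the maximality
  of the total weight, the second that of the weight on \<open>m\<close>.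
\<close>

lemma max_load_covering:
  fixes E :: "'n::finite set set"
  assumes simple: "simple_graph E" and m: "m \<subseteq> E" "\<And>v. \<exists>!e. e \<in> m \<and> v \<in> e"
    and k: "\<And>v. k \<le> c v"
  obtains w where "sum w E = max_load_size E c" "\<And>v. k \<le> load E w v" "\<And>v. load E w v \<le> c v"
proof -
  let ?S = "\<lambda>w. sum w E = max_load_size E c \<and> (\<forall>v. load E w v \<le> c v)"
  obtain w0 where "?S w0" using max_load_attained[OF simple, of c] by metis
  moreover have "\<forall>w. ?S w \<longrightarrow> sum w m < Suc (max_load_size E c)"
    using m(1) by (metis finite sum_mono2 zero_le less_Suc_eq_le)
  ultimately obtain w where w: "?S w" and best: "\<And>w'. ?S w' \<Longrightarrow> sum w' m \<le> sum w m"
    using ex_has_greatest_nat[of ?S w0 "\<lambda>w. sum w m" "Suc (max_load_size E c)"] by blast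
  have "k \<le> load E w v" for v
  proof (rule ccontr)
    assume "\<not> k \<le> load E w v"
    then have lv: "load E w v < k" by simp
    obtain e where e: "e \<in> m" "v \<in> e" using m(2) by blast
    then have "e \<in> E" using m(1) by blast
    then obtain x y where "e = {x, y}" "x \<noteq> y"
      using simple by (metis simple_graph_def card_2_iff)
    then obtain b where b: "e = {v, b}" "v \<noteq> b"
      using e(2) by (metis insert_commute insert_iff singletonD)
    have "load E w b = c b"
    proof (rule ccontr)
      assume "load E w b \<noteq> c b"
      then have "load E w b < c b" using w le_neq_implies_less by blast
      then have "load E (w(e := w e + 1)) u \<le> c u" for u
        using load_fun_upd[OF \<open>e \<in> E\<close>, of w 1 u] b lv k[of v] w by auto
      then have "sum (w(e := w e + 1)) E \<le> max_load_size E c"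
        by (rule sum_le_max_load_size[OF simple])
      then show False using sum_fun_upd[OF \<open>e \<in> E\<close>, of w 1] w by simp
    qed
    moreover have "w e \<le> load E w v"
      unfolding load_def using \<open>e \<in> E\<close> e(2) by (intro member_le_sum) auto
    \<comment> \<open>The chain is \<open>w e \<le> load E w v < k \<le> c b = load E w b\<close>;
      the matching edge alone thus cannot account for the load at \<open>b\<close>.\<close>
    ultimately have less: "w e < load E w b" using lv k[of b] by linarith
    have "\<exists>e'\<in>{e' \<in> E. b \<in> e'} - {e}. w e' \<noteq> 0"
    proof (rule ccontr)
      assume none: "\<not> (\<exists>e'\<in>{e' \<in> E. b \<in> e'} - {e}. w e' \<noteq> 0)"
      have "e \<in> {e' \<in> E. b \<in> e'}" using \<open>e \<in> E\<close> b(1) by simp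
      then have "load E w b = sum w {e}"
        unfolding load_def using none by (intro sum.mono_neutral_right finite) blast+
      then show False using less by simp
    qed
    then obtain e' where e': "e' \<in> E" "b \<in> e'" "e' \<noteq> e" "w e' > 0" by auto
    then have "e' \<notin> m" using m(2)[of b] e(1) b by blast
    define w' where "w' = w(e' := w e' - 1)"
    define w'' where "w'' = w'(e := w' e + 1)"
    have w': "w = w'(e' := w' e' + 1)" using e' by (simp add: w'_def)
    \<comment> \<open>The exchange can raise the load only at \<open>v\<close>, which was below
      \<open>k\<close> and hence below \<open>c v\<close>; at \<open>b\<close> loss and gain
      cancel.\<close>
    have "load E w'' u \<le> c u" for u
      using load_fun_upd[OF \<open>e' \<in> E\<close>, of w' 1 u] load_fun_upd[OF \<open>e \<in> E\<close>, of w' 1 u]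
        lv k[of v] w[THEN conjunct2, rule_format, of u] b e'(2)
      unfolding w'[symmetric] w''_def[symmetric] by (auto split: if_splits)
    moreover have "sum w'' E = sum w E"
      using sum_fun_upd[OF \<open>e' \<in> E\<close>, of w' 1] sum_fun_upd[OF \<open>e \<in> E\<close>, of w' 1]
      unfolding w'[symmetric] w''_def[symmetric] by simp
    ultimately have "sum w'' m \<le> sum w m" using best w by simp
    moreover have "sum w'' m = sum w' m + 1" unfolding w''_def by (rule sum_fun_upd[OF e(1)])
    moreover have "sum w' m = sum w m"
      unfolding w'_def using \<open>e' \<notin> m\<close> by (intro sum.cong) auto
    ultimately show False by simp
  qed
  then show thesis using that w by blast
qed

subsection \<open>Cubes and reflexive polytopes\<close>

lemma dual_body_inner: "dual_body P = {x. \<forall>y\<in>P. x \<bullet> y \<le> 1}"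
  by (simp add: dual_body_def inner_vec_def)

text \<open>Extreme points of a convex hull are found among the generating points.\<close>

lemma lattice_polytope_convex_hull:
  assumes "finite S" "\<And>v i. v \<in> S \<Longrightarrow> v $ i \<in> \<int>"
  shows "lattice_polytope (convex hull S)"
  unfolding lattice_polytope_def
  using assms extreme_point_of_convex_hull[of _ S] by (auto simp: polytope_def)

lemma finite_two_valued_vectors: "finite {x :: real ^ 'n::finite. \<forall>i. x $ i = a \<or> x $ i = b}"
proof (rule finite_subset)
  show "{x :: real ^ 'n. \<forall>i. x $ i = a \<or> x $ i = b} \<subseteq> range (\<lambda>f :: 'n \<Rightarrow> bool. \<chi> i. if f i then a else b)"
  proof
    fix x :: "real ^ 'n" assume "x \<in> {x. \<forall>i. x $ i = a \<or> x $ i = b}"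
    then show "x \<in> range (\<lambda>f :: 'n \<Rightarrow> bool. \<chi> i. if f i then a else b)"
      by (intro image_eqI[of _ _ "\<lambda>i. x $ i = a"]) (auto simp: vec_eq_iff)
  qed
qed simp

text \<open>The cube is an affine image of the unit box, and affine maps commute with convex
  hulls.\<close>

lemma cube_eq_convex_hull:
  fixes a b :: real
  assumes "a < b"
  shows "{x :: real ^ 'n::finite. \<forall>i. a \<le> x $ i \<and> x $ i \<le> b}
       = convex hull {x. \<forall>i. x $ i = a \<or> x $ i = b}"
proof -
  let ?f = "\<lambda>x :: real ^ 'n. (\<chi> i. a) + (b - a) *\<^sub>R x"
  have inv: "?f (\<chi> i. (x $ i - a) / (b - a)) = x" for x
    using assms by (simp add: vec_eq_iff)
  have "{x :: real ^ 'n. \<forall>i. a \<le> x $ i \<and> x $ i \<le> b} = ?f ` cbox 0 1"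
  proof (intro subset_antisym subsetI)
    fix x :: "real ^ 'n" assume "x \<in> {x. \<forall>i. a \<le> x $ i \<and> x $ i \<le> b}"
    then have "(\<chi> i. (x $ i - a) / (b - a)) \<in> cbox (0 :: real ^ 'n) 1"
      using assms by (simp add: mem_box_cart divide_simps)
    then show "x \<in> ?f ` cbox 0 1"
      by (rule image_eqI[where f = ?f, OF inv[of x, symmetric]])
  next
    fix x assume "x \<in> ?f ` cbox 0 1"
    then obtain y where y: "x = ?f y" "y \<in> cbox 0 1" by blast
    then have "0 \<le> y $ i" "y $ i \<le> 1" for i by (simp_all add: mem_box_cart)
    then have "0 \<le> (b - a) * y $ i" "(b - a) * y $ i \<le> b - a" for i
      using assms by (simp_all add: mult_left_le)
    then show "x \<in> {x. \<forall>i. a \<le> x $ i \<and> x $ i \<le> b}"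
      unfolding y(1) by (simp add: le_diff_eq add.commute)
  qed
  also have "cbox (0 :: real ^ 'n) 1 = convex hull {x. \<forall>i. x $ i = 0 \<or> x $ i = 1}"
    unfolding Cart_1 unit_interval_convex_hull[where 'a = "real ^ 'n"]
    by (simp add: Basis_vec_def inner_axis)
  also have "?f ` (convex hull {x. \<forall>i. x $ i = 0 \<or> x $ i = 1}) = convex hull (?f ` {x. \<forall>i. x $ i = 0 \<or> x $ i = 1})"
    by (rule convex_hull_affinity[symmetric])
  also have "?f ` {x. \<forall>i. x $ i = 0 \<or> x $ i = 1} = {x. \<forall>i. x $ i = a \<or> x $ i = b}"
  proof (intro subset_antisym subsetI)
    fix x :: "real ^ 'n" assume x: "x \<in> {x. \<forall>i. x $ i = a \<or> x $ i = b}"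
    have "(x $ i - a) / (b - a) = 0 \<or> (x $ i - a) / (b - a) = 1" for i
      using x assms by (cases "x $ i = a") auto
    then have "(\<chi> i. (x $ i - a) / (b - a)) \<in> {x :: real ^ 'n. \<forall>i. x $ i = 0 \<or> x $ i = 1}" by simp
    then show "x \<in> ?f ` {x. \<forall>i. x $ i = 0 \<or> x $ i = 1}"
      by (rule image_eqI[where f = ?f, OF inv[of x, symmetric]])
  next
    fix x assume "x \<in> ?f ` {x. \<forall>i. x $ i = 0 \<or> x $ i = 1}"
    then obtain y where y: "x = ?f y" "\<forall>i. y $ i = 0 \<or> y $ i = 1" by blast
    have "x $ i = a \<or> x $ i = b" for i using y(2)[rule_format, of i] unfolding y(1) by auto
    then show "x \<in> {x. \<forall>i. x $ i = a \<or> x $ i = b}" by simp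
  qed
  finally show ?thesis .
qed

lemma lattice_polytope_cube:
  fixes a b :: int
  assumes "a < b"
  shows "lattice_polytope {x :: real ^ 'n::finite. \<forall>i. of_int a \<le> x $ i \<and> x $ i \<le> of_int b}"
proof -
  have "v $ i \<in> \<int>" if "v \<in> {x :: real ^ 'n. \<forall>i. x $ i = of_int a \<or> x $ i = of_int b}" for v i
  proof -
    have "v $ i = of_int a \<or> v $ i = of_int b" using that by blast
    then show ?thesis by (metis Ints_of_int)
  qed
  moreover have "real_of_int a < real_of_int b" using assms by simp
  ultimately show ?thesis
    by (simp only: cube_eq_convex_hull lattice_polytope_convex_hull finite_two_valued_vectors)
qed

lemma interior_cube:
  "interior {x :: real ^ 'n::finite. \<forall>i. a \<le> x $ i \<and> x $ i \<le> b} = {x. \<forall>i. a < x $ i \<and> x $ i < b}"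
proof -
  have "{x :: real ^ 'n. \<forall>i. a \<le> x $ i \<and> x $ i \<le> b} = cbox (\<chi> i. a) (\<chi> i. b)"
    by (auto simp: mem_box_cart)
  then show ?thesis by (simp add: interior_cbox) (auto simp: mem_box_cart)
qed

lemma aff_dim_cube:
  assumes "a < b"
  shows "aff_dim {x :: real ^ 'n::finite. \<forall>i. a \<le> x $ i \<and> x $ i \<le> b} = int CARD('n)"
proof -
  obtain c where "a < c" "c < b" using assms dense by blast
  then have "(\<chi> i. c) \<in> interior {x :: real ^ 'n. \<forall>i. a \<le> x $ i \<and> x $ i \<le> b}"
    unfolding interior_cube by simp
  then show ?thesis using aff_dim_nonempty_interior by fastforce
qed

section \<open>The cross-polytope as dual of the cube\<close>

text \<open>An explicit convex combination: weight \<bar>\<open>y $ i\<close>\<bar> goes on the unit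
  vector with the sign of \<open>y $ i\<close>, and the remaining weight goes on the origin, which
  the index \<open>None\<close> stands for.\<close>

lemma sum_abs_le_one_in_cross_polytope:
  fixes y :: "real ^ 'n::finite"
  assumes "(\<Sum>i\<in>UNIV. \<bar>y $ i\<bar>) \<le> 1"
  shows "y \<in> convex hull (insert 0 (range (\<lambda>i. axis i 1) \<union> range (\<lambda>i. axis i (- 1))))" (is "_ \<in> ?C")
proof -
  let ?u = "\<lambda>j. case j of None \<Rightarrow> 1 - (\<Sum>i\<in>UNIV. \<bar>y $ i\<bar>) | Some i \<Rightarrow> \<bar>y $ i\<bar>"
  let ?p = "\<lambda>j. case j of None \<Rightarrow> 0 | Some i \<Rightarrow> axis i (if 0 \<le> y $ i then 1 else - 1)"
  have C: "?p j \<in> ?C" for j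
    by (intro hull_inc) (auto split: option.split)
  have "(\<Sum>j\<in>UNIV. ?u j *\<^sub>R ?p j) \<in> ?C"
    by (rule convex_sum) (use assms C in \<open>auto simp: UNIV_option_conv sum.reindex split: option.split\<close>)
  also have "(\<Sum>j\<in>UNIV. ?u j *\<^sub>R ?p j) = (\<Sum>i\<in>UNIV. \<bar>y $ i\<bar> *\<^sub>R axis i (if 0 \<le> y $ i then 1 else - 1))"
    by (simp add: UNIV_option_conv sum.reindex)
  also have "\<dots> = y"
    by (simp add: vec_eq_iff axis_def if_distrib[of "\<lambda>x. _ * x"] cong: if_cong)
  finally show ?thesis .
qed

text \<open>Pairing \<open>y\<close> with its own sign vector, a point of the cube, bounds the sum
  of absolute values by 1. Conversely the dual body is convex, so only the generating points need
  checking.\<close>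

lemma dual_body_centered_cube:
  "dual_body {x :: real ^ 'n::finite. \<forall>i. - 1 \<le> x $ i \<and> x $ i \<le> 1}
     = convex hull (insert 0 (range (\<lambda>i. axis i 1) \<union> range (\<lambda>i. axis i (- 1))))" (is "dual_body ?Q = convex hull ?S")
proof (intro subset_antisym subsetI)
  fix y assume "y \<in> dual_body ?Q"
  moreover have "(\<chi> i. sgn (y $ i)) \<in> ?Q" by (simp add: sgn_if)
  ultimately have "(\<Sum>i\<in>UNIV. y $ i * (\<chi> i. sgn (y $ i)) $ i) \<le> 1"
    unfolding dual_body_def by blast
  then have "(\<Sum>i\<in>UNIV. \<bar>y $ i\<bar>) \<le> 1" by (simp add: abs_sgn)
  then show "y \<in> convex hull ?S" by (rule sum_abs_le_one_in_cross_polytope)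
next
  have "convex (dual_body ?Q)"
  proof -
    have "dual_body ?Q = (\<Inter>q\<in>?Q. {x. q \<bullet> x \<le> 1})"
      unfolding dual_body_inner by (auto simp: inner_commute)
    then show ?thesis by (simp only:) (intro convex_INT convex_halfspace_le)
  qed
  moreover have "?S \<subseteq> dual_body ?Q"
    unfolding dual_body_inner by (auto simp: inner_axis' minus_le_iff)
  ultimately have "convex hull ?S \<subseteq> dual_body ?Q" by (rule hull_minimal[rotated])
  then show "y \<in> dual_body ?Q" if "y \<in> convex hull ?S" for y using that by blast
qed

lemma reflexive_centered_cube:
  "reflexive_polytope {x :: real ^ 'n::finite. \<forall>i. - 1 \<le> x $ i \<and> x $ i \<le> 1}"
  unfolding reflexive_polytope_def
proof (intro conjI)
  show "lattice_polytope {x :: real ^ 'n. \<forall>i. - 1 \<le> x $ i \<and> x $ i \<le> 1}"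
    using lattice_polytope_cube[of "- 1" 1] by simp
  show "aff_dim {x :: real ^ 'n. \<forall>i. - 1 \<le> x $ i \<and> x $ i \<le> 1} = int CARD('n)"
    by (rule aff_dim_cube) simp
  show "0 \<in> interior {x :: real ^ 'n. \<forall>i. - 1 \<le> x $ i \<and> x $ i \<le> 1}"
    unfolding interior_cube by simp
  show "lattice_polytope (dual_body {x :: real ^ 'n. \<forall>i. - 1 \<le> x $ i \<and> x $ i \<le> 1})"
    unfolding dual_body_centered_cube
    by (rule lattice_polytope_convex_hull) (auto simp: axis_def)
qed

text \<open>Dilation by \<open>\<delta>\<close> followed by the shift by \<open>(1, ..., 1)\<close>
  carries the cube onto [-1,1]^n, precisely because \<open>\<delta> * k = 2\<close>.\<close>

lemma gorenstein_cube:
  fixes k \<delta> :: int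
  assumes "0 < k" "\<delta> * k = 2"
  shows "gorenstein_polytope {x :: real ^ 'n::finite. \<forall>i. 0 \<le> x $ i \<and> x $ i \<le> of_int k}" (is "gorenstein_polytope ?P")
  unfolding gorenstein_polytope_def
proof (intro conjI exI)
  show "lattice_polytope ?P" using lattice_polytope_cube[of 0 k] assms by simp
  show "aff_dim ?P = int CARD('n)" by (rule aff_dim_cube) (use assms in simp)
  show \<delta>: "0 < \<delta>" using assms by (metis zero_less_mult_pos2 zero_less_numeral)
  have dk: "real_of_int \<delta> * real_of_int k = 2" using assms(2) by (metis of_int_mult of_int_numeral)
  let ?f = "\<lambda>x :: real ^ 'n. real_of_int \<delta> *\<^sub>R x - (\<chi> i. real_of_int ((\<chi> i. 1) $ i))"
  have "?f ` ?P = {x. \<forall>i. - 1 \<le> x $ i \<and> x $ i \<le> 1}"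
  proof (intro subset_antisym subsetI)
    fix y assume "y \<in> ?f ` ?P"
    then obtain x where x: "y = ?f x" "x \<in> ?P" by blast
    have "0 \<le> real_of_int \<delta> * x $ i" "real_of_int \<delta> * x $ i \<le> 2" for i
      using x(2) mult_left_mono[of "x $ i" "real_of_int k" "real_of_int \<delta>"] \<delta> dk by simp_all
    then show "y \<in> {x. \<forall>i. - 1 \<le> x $ i \<and> x $ i \<le> 1}" unfolding x(1) by (simp add: algebra_simps)
  next
    fix y :: "real ^ 'n" assume y: "y \<in> {x. \<forall>i. - 1 \<le> x $ i \<and> x $ i \<le> 1}"
    have y_eq: "?f (\<chi> i. (y $ i + 1) / of_int \<delta>) = y" using \<delta> by (simp add: vec_eq_iff)
    have "(y $ i + 1) / of_int \<delta> \<le> of_int k" "0 \<le> (y $ i + 1) / of_int \<delta>" for i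
      using y[simplified, rule_format, of i] \<delta> dk by (simp_all add: divide_simps mult.commute)
    then have "(\<chi> i. (y $ i + 1) / of_int \<delta>) \<in> ?P" by simp
    then show "y \<in> ?f ` ?P" by (rule image_eqI[where f = ?f, OF y_eq[symmetric]])
  qed
  then show "reflexive_polytope (?f ` ?P)" by (simp only: reflexive_centered_cube)
qed

section \<open>Vertices of dual polytopes and the Gorenstein condition\<close>

lemma polytope_eq_convex_hull_extreme_points:
  fixes P :: "'a::euclidean_space set"
  assumes "polytope P"
  shows "P = convex hull {v. v extreme_point_of P}"
  by (rule Krein_Milman_Minkowski[OF polytope_imp_compact[OF assms] polytope_imp_convex[OF assms]])

text \<open>If \<open>y\<close> lies inside a segment with ends in \<open>S\<close>, each inequality
  \<open>z \<bullet> q \<le> 1\<close>, being tight at \<open>y\<close>, is tight at both ends;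
  uniqueness then makes both ends equal to \<open>y\<close>.\<close>

lemma extreme_point_of_linear_faces:
  fixes y :: "'a::real_inner"
  assumes y: "y \<in> S"
    and F: "\<And>z q. z \<in> S \<Longrightarrow> q \<in> F \<Longrightarrow> z \<bullet> q \<le> 1"
    and unique: "\<And>z. (\<forall>q\<in>F. z \<bullet> q = 1) \<longleftrightarrow> z = y"
  shows "y extreme_point_of S"
  unfolding extreme_point_of_def
proof (intro conjI ballI notI y)
  fix a b assume ab: "a \<in> S" "b \<in> S" "y \<in> open_segment a b"
  then obtain u where u: "0 < u" "u < 1" "y = (1 - u) *\<^sub>R a + u *\<^sub>R b" "a \<noteq> b"
    unfolding in_segment by blast
  have "a \<bullet> q = 1 \<and> b \<bullet> q = 1" if q: "q \<in> F" for q
  proof -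
    have "(1 - u) * (a \<bullet> q) + u * (b \<bullet> q) = 1"
      using unique[of y] q u(3) by (metis inner_add_left inner_scaleR_left)
    moreover have "(1 - u) * (a \<bullet> q) \<le> 1 - u" "u * (b \<bullet> q) \<le> u"
      using F[OF ab(1) q] F[OF ab(2) q] u by (simp_all add: mult_left_le)
    ultimately have "(1 - u) * (a \<bullet> q) = 1 - u" "u * (b \<bullet> q) = u" by linarith+
    then show ?thesis using u by simp
  qed
  then show False using unique[of a] unique[of b] u(4) by auto
qed

text \<open>
  The facets \<open>x\<^sub>i \<ge> 0\<close> sit at lattice distance \<open>a\<^sub>i\<close> from the interior point; integrality of the
  dual vertex \<open>- e\<^sub>i / a\<^sub>i\<close> forces \<open>a\<^sub>i = 1\<close>.
\<close>

lemma reflexive_translate_eq_one: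
  fixes P :: "(real ^ 'n::finite) set" and \<delta> :: int and a :: "int ^ 'n"
  assumes refl: "reflexive_polytope ((\<lambda>x. real_of_int \<delta> *\<^sub>R x - (\<chi> i. real_of_int (a $ i))) ` P)"
    and \<delta>: "\<delta> > 0" and nonneg: "\<And>x i. x \<in> P \<Longrightarrow> 0 \<le> x $ i"
    and P: "0 \<in> P" "\<And>i. axis i 1 \<in> P"
  shows "a $ i = 1"
proof -
  define f where "f = (\<lambda>x :: real ^ 'n. real_of_int \<delta> *\<^sub>R x - (\<chi> i. real_of_int (a $ i)))"
  let ?D = "dual_body (f ` P)"
  have fi: "f x $ j = \<delta> * x $ j - a $ j" for x j by (simp add: f_def)
  have "0 \<in> interior (f ` P)" using refl by (simp add: reflexive_polytope_def f_def)
  then obtain e where e: "e > 0" "cball 0 e \<subseteq> f ` P" using mem_interior_cball by blast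
  \<comment> \<open>Moving from the interior point 0 a little in the direction
    \<open>- axis i 1\<close> stays inside, so 0 has positive distance from the facet and
    \<open>a $ i > 0\<close>.\<close>
  have "axis i (- e) \<in> cball 0 e" using e(1) by (simp add: norm_eq_sqrt_inner inner_axis_axis)
  then obtain x where x: "x \<in> P" "axis i (- e) = f x" using e(2) by blast
  have "- e = \<delta> * x $ i - a $ i" using x(2) fi[of x i] by (metis axis_nth)
  moreover have "0 \<le> \<delta> * x $ i" using nonneg[OF x(1), of i] \<delta> by simp
  ultimately have "real_of_int (a $ i) > 0" using e(1) by linarith
  then have a: "a $ i > 0" by simp
  let ?y = "axis i (- 1 / a $ i) :: real ^ 'n"
  have "?y \<in> ?D"
    unfolding dual_body_inner
  proof safe
    fix x assume "x \<in> P"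
    then have "0 \<le> \<delta> * x $ i" using nonneg \<delta> by simp
    then show "?y \<bullet> f x \<le> 1" using a by (simp add: inner_axis' fi divide_simps)
  qed
  \<comment> \<open>The images of 0 and of the unit vectors other than \<open>axis i 1\<close> are
    CARD('n) points on the facet of vanishing \<open>i\<close>-th coordinate; their equations
    determine the dual vertex.\<close>
  have "?y extreme_point_of ?D"
  proof (rule extreme_point_of_linear_faces[where F = "insert (f 0) ((\<lambda>j. f (axis j 1)) ` (- {i}))"])
    show "?y \<in> ?D" by fact
    show "z \<bullet> q \<le> 1" if "z \<in> ?D" "q \<in> insert (f 0) ((\<lambda>j. f (axis j 1)) ` (- {i}))" for z q
      using that P by (auto simp: dual_body_inner)
    fix z
    have f_axis: "z \<bullet> f (axis j 1) = \<delta> * z $ j + z \<bullet> f 0" for z j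
      by (simp add: f_def inner_diff_right inner_axis)
    show "(\<forall>q \<in> insert (f 0) ((\<lambda>j. f (axis j 1)) ` (- {i})). z \<bullet> q = 1) \<longleftrightarrow> z = ?y"
    proof
      assume *: "\<forall>q \<in> insert (f 0) ((\<lambda>j. f (axis j 1)) ` (- {i})). z \<bullet> q = 1"
      \<comment> \<open>Subtracting the equation at \<open>f 0\<close> from that at
        \<open>f (axis j 1)\<close> leaves \<open>\<delta> * z $ j = 0\<close>; the equation at
        \<open>f 0\<close> then fixes the one remaining coordinate.\<close>
      have z0: "z \<bullet> f 0 = 1" using * by simp
      have zj: "z $ j = 0" if "j \<noteq> i" for j
        using * that z0 f_axis[of z j] \<delta> by simp
      have z: "z = axis i (z $ i)" using zj by (auto simp: vec_eq_iff axis_def)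
      have "z $ i * - real_of_int (a $ i) = 1"
        using z0 by (subst (asm) z) (simp add: inner_axis' fi)
      then have "z $ i = - 1 / a $ i" using a by (simp add: field_simps)
      then show "z = ?y" using z by simp
    next
      have axis_0: "(axis j 1 :: real ^ 'n) $ i = 0" if "j \<noteq> i" for j
        using that by (simp add: axis_def)
      assume "z = ?y"
      then show "\<forall>q \<in> insert (f 0) ((\<lambda>j. f (axis j 1)) ` (- {i})). z \<bullet> q = 1"
        using a axis_0 by (auto simp: inner_axis' fi)
    qed
  qed
  then have "?y $ i \<in> \<int>" using refl unfolding reflexive_polytope_def lattice_polytope_def f_def by blast
  then have "- 1 / real_of_int (a $ i) \<in> \<int>" by (simp only: axis_nth)
  then obtain k where "- 1 / real_of_int (a $ i) = of_int k" by (rule Ints_cases)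
  then have "real_of_int (k * a $ i) = real_of_int (- 1)" using a by (simp add: field_simps)
  then have "k * a $ i = - 1" by (simp only: of_int_eq_iff)
  then have "a $ i dvd 1" by (metis dvd_minus_iff dvd_triv_right)
  then show ?thesis using a by simp
qed

text \<open>A positive integral coordinate is at least 1 and already exhausts the bound, so all
  others vanish.\<close>

lemma integral_abs_le_one_cases:
  fixes y :: "real ^ 'n::finite"
  assumes "\<And>j. y $ j \<in> \<int>" "(\<Sum>j\<in>UNIV. \<bar>y $ j\<bar>) \<le> 1" "y $ i > 0"
  shows "y = axis i 1"
proof -
  obtain k where k: "y $ i = of_int k" using assms(1) Ints_cases by metis
  then have "1 \<le> y $ i" using assms(3) by simp
  moreover have s: "(\<Sum>j\<in>UNIV. \<bar>y $ j\<bar>) = \<bar>y $ i\<bar> + (\<Sum>j\<in>UNIV - {i}. \<bar>y $ j\<bar>)"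
    by (rule sum.remove) auto
  moreover have nn: "(\<Sum>j\<in>UNIV - {i}. \<bar>y $ j\<bar>) \<ge> 0" by (rule sum_nonneg) simp
  ultimately have "y $ i = 1" "(\<Sum>j\<in>UNIV - {i}. \<bar>y $ j\<bar>) = 0" using assms(2) by linarith+
  moreover from this(2) have "\<forall>j\<in>UNIV - {i}. \<bar>y $ j\<bar> = 0"
    by (subst (asm) sum_nonneg_eq_0_iff) auto
  ultimately show ?thesis by (auto simp: vec_eq_iff axis_def)
qed

text \<open>
  A vertex \<open>y\<close> of the dual satisfies \<open>\<Sum>\<bar>y\<^sub>i\<bar> \<le> 1\<close> as soon as the polytope contains the cube
  \<open>[-1, 1]\<^sup>n\<close>, so all facets are among the facets of that cube.
\<close>

lemma reflexive_bounded_by_cube: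
  fixes Q :: "(real ^ 'n::finite) set"
  assumes refl: "reflexive_polytope Q"
    and signs: "\<And>s :: 'n \<Rightarrow> bool. \<exists>q\<in>Q. \<forall>i. if s i then 1 \<le> q $ i else q $ i \<le> - 1"
    and q: "q \<in> Q"
  shows "q $ i \<le> 1"
proof -
  let ?D = "dual_body Q"
  let ?X = "{v. v extreme_point_of ?D}"
  have lat: "lattice_polytope Q" "lattice_polytope ?D" using refl by (auto simp: reflexive_polytope_def)
  have hull: "?D = convex hull ?X"
    using lat(2) polytope_eq_convex_hull_extreme_points unfolding lattice_polytope_def by blast
  have int: "v $ j \<in> \<int>" if "v \<in> ?X" for v j using lat(2) that unfolding lattice_polytope_def by blast
  have abs: "(\<Sum>j\<in>UNIV. \<bar>v $ j\<bar>) \<le> 1" if v: "v \<in> ?X" for v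
  proof -
    \<comment> \<open>The point of \<open>Q\<close> is taken in the direction of the signs of
      \<open>v\<close>; where \<open>v $ j\<close> is zero either choice will do.\<close>
    obtain q where q: "q \<in> Q" "\<And>j. if v $ j > 0 then 1 \<le> q $ j else q $ j \<le> - 1"
      using signs[of "\<lambda>j. v $ j > 0"] by blast
    have "(\<Sum>j\<in>UNIV. \<bar>v $ j\<bar>) \<le> (\<Sum>j\<in>UNIV. v $ j * q $ j)"
    proof (rule sum_mono)
      fix j
      show "\<bar>v $ j\<bar> \<le> v $ j * q $ j"
        using q(2)[of j] mult_left_mono[of 1 "q $ j" "v $ j"] mult_left_mono_neg[of "q $ j" "- 1" "v $ j"]
        by (auto split: if_splits)
    qed
    also have "\<dots> \<le> 1" using v q(1) by (auto simp: extreme_point_of_def dual_body_def)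
    finally show ?thesis .
  qed
  \<comment> \<open>Otherwise every vertex of the dual has a nonpositive \<open>i\<close>-th
    coordinate, and so has the whole dual. But \<open>Q\<close> is bounded, so the dual contains a
    small positive multiple of \<open>axis i 1\<close>.\<close>
  have "axis i 1 \<in> ?X"
  proof (rule ccontr)
    assume no: "axis i 1 \<notin> ?X"
    have "?X \<subseteq> {v. axis i 1 \<bullet> v \<le> 0}"
    proof
      fix v assume v: "v \<in> ?X"
      have "\<not> v $ i > 0" using integral_abs_le_one_cases[OF int[OF v] abs[OF v]] no v by metis
      then show "v \<in> {v. axis i 1 \<bullet> v \<le> 0}" by (simp add: inner_axis')
    qed
    then have sub: "?D \<subseteq> {v. axis i 1 \<bullet> v \<le> 0}"
      by (subst hull) (intro hull_minimal convex_halfspace_le)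
    have "bounded Q" using lat(1) polytope_imp_bounded unfolding lattice_polytope_def by blast
    then obtain B where B: "B > 0" "\<And>q. q \<in> Q \<Longrightarrow> norm q \<le> B" by (meson bounded_pos)
    have "axis i (1 / B) \<in> ?D"
      unfolding dual_body_inner
    proof safe
      fix q assume "q \<in> Q"
      then have "q $ i \<le> B" using B(2) component_le_norm_cart[of q i] by fastforce
      then show "axis i (1 / B) \<bullet> q \<le> 1" using B(1) by (simp add: inner_axis')
    qed
    then have "axis i 1 \<bullet> axis i (1 / B) \<le> (0 :: real)" using sub by blast
    then show False using B(1) by (simp add: inner_axis')
  qed
  then have "axis i 1 \<bullet> q \<le> 1" using q unfolding extreme_point_of_def dual_body_inner by blast
  then show ?thesis by (simp add: inner_axis')
qed

text \<open>The polyhedral core, with the graph abstracted away: \<open>one\<close> and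
  \<open>two\<close> record that \<open>V\<close> contains the corners of [0,1]^n, and those of
  [0,2]^n once every coordinate exceeds 1 somewhere.\<close>

lemma gorenstein_hull_cases:
  fixes V :: "(real ^ 'n::finite) set"
  assumes gor: "gorenstein_polytope (convex hull V)"
    and nonneg: "\<And>x i. x \<in> V \<Longrightarrow> 0 \<le> x $ i"
    and one: "\<And>x. (\<forall>i. x $ i = 0 \<or> x $ i = 1) \<Longrightarrow> x \<in> V"
    and two: "\<And>x. (\<forall>i. \<exists>v\<in>V. v $ i > 1) \<Longrightarrow> (\<forall>i. x $ i = 0 \<or> x $ i = 2) \<Longrightarrow> x \<in> V"
  shows "convex hull V = {x. \<forall>i. 0 \<le> x $ i \<and> x $ i \<le> 1} \<or>
         convex hull V = {x. \<forall>i. 0 \<le> x $ i \<and> x $ i \<le> 2}"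
proof -
  let ?P = "convex hull V"
  obtain \<delta> :: int and a :: "int ^ 'n" where \<delta>: "\<delta> > 0"
    and refl: "reflexive_polytope ((\<lambda>x. real_of_int \<delta> *\<^sub>R x - (\<chi> i. real_of_int (a $ i))) ` ?P)"
    using gor unfolding gorenstein_polytope_def by blast
  have Pnonneg: "0 \<le> x $ i" if "x \<in> ?P" for x i
  proof -
    have "?P \<subseteq> {x. axis i 1 \<bullet> x \<ge> 0}"
      by (intro hull_minimal convex_halfspace_ge) (use nonneg in \<open>auto simp: inner_axis'\<close>)
    then show ?thesis using that by (auto simp: inner_axis')
  qed
  have VP: "V \<subseteq> ?P" by (rule hull_subset)
  have "a $ i = 1" for i
    by (rule reflexive_translate_eq_one[OF refl \<delta> Pnonneg])
      (use VP one in \<open>auto simp: axis_def intro!: subsetD[OF VP] one\<close>)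
  then have refl: "reflexive_polytope ((\<lambda>x. real_of_int \<delta> *\<^sub>R x - 1) ` ?P)" (is "reflexive_polytope (?f ` ?P)")
    using refl by (simp add: one_vec_def)
  \<comment> \<open>For \<open>\<delta> = 1\<close> the point \<open>(1, ..., 1)\<close> is interior
    to the hull, so no coordinate can be bounded by 1 on \<open>V\<close>.\<close>
  have big: "\<exists>v\<in>V. v $ i > 1" if "\<delta> = 1" for i
  proof (rule ccontr)
    assume no: "\<not> (\<exists>v\<in>V. v $ i > 1)"
    have sub: "?P \<subseteq> {x. axis i 1 \<bullet> x \<le> 1}"
      by (intro hull_minimal convex_halfspace_le) (use no in \<open>auto simp: inner_axis' not_less\<close>)
    have "0 \<in> interior (?f ` ?P)" using refl by (simp add: reflexive_polytope_def)
    then obtain e where e: "e > 0" "cball 0 e \<subseteq> ?f ` ?P" using mem_interior_cball by blast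
    have "axis i e \<in> cball 0 e" using e(1) by (simp add: norm_eq_sqrt_inner inner_axis_axis)
    then obtain x where x: "x \<in> ?P" "axis i e = ?f x" using e(2) by blast
    have "e = ?f x $ i" using x(2) by (metis axis_nth)
    then have "e = x $ i - 1" using that by simp
    moreover have "x $ i \<le> 1" using x(1) sub by (auto simp: inner_axis')
    ultimately show False using e(1) by simp
  qed
  \<comment> \<open>The side length of a cube whose corners are known to lie in \<open>V\<close>,
    large enough that \<open>\<delta> * k \<ge> 2\<close>: the images of these corners reach at
    least 1 or at most -1 in every coordinate, as \<open>reflexive_bounded_by_cube\<close>
    requires.\<close>
  define k :: int where "k = (if \<delta> = 1 then 2 else 1)"
  have corner: "x \<in> V" if "\<forall>i. x $ i = 0 \<or> x $ i = of_int k" for x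
    using that one two big unfolding k_def by (cases "\<delta> = 1") auto
  have \<delta>k: "\<delta> * k \<ge> 2" using \<delta> unfolding k_def by simp
  have le: "real_of_int \<delta> * x $ i \<le> 2" if "x \<in> ?P" for x i
  proof -
    have "?f x $ i \<le> 1"
    proof (rule reflexive_bounded_by_cube[OF refl])
      show "?f x \<in> ?f ` ?P" using that by (rule imageI)
      show "\<exists>q\<in>?f ` ?P. \<forall>i. if s i then 1 \<le> q $ i else q $ i \<le> - 1" for s :: "'n \<Rightarrow> bool"
      proof
        let ?x = "\<chi> i. if s i then of_int k else (0 :: real)"
        show "?f ?x \<in> ?f ` ?P" by (intro imageI subsetD[OF VP] corner) simp
        have "real_of_int \<delta> * real_of_int k \<ge> 2" using \<delta>k by (metis of_int_le_iff of_int_mult of_int_numeral)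
        then show "\<forall>i. if s i then 1 \<le> ?f ?x $ i else ?f ?x $ i \<le> - 1" by simp
      qed
    qed
    then show ?thesis by simp
  qed
  \<comment> \<open>Applying the upper bound to the corner \<open>(k, ..., k)\<close> forces
    \<open>\<delta> * k = 2\<close>; this excludes \<open>\<delta> \<ge> 3\<close>.\<close>
  have "(\<chi> i. of_int k) \<in> ?P" by (intro subsetD[OF VP] corner) simp
  from le[OF this] have "real_of_int \<delta> * real_of_int k \<le> 2" by simp
  then have "\<delta> * k \<le> 2" by (metis of_int_le_iff of_int_mult of_int_numeral)
  then have \<delta>k2: "\<delta> * k = 2" using \<delta>k by simp
  have k: "k = 1 \<or> k = 2" by (simp add: k_def)
  have "?P = {x. \<forall>i. 0 \<le> x $ i \<and> x $ i \<le> of_int k}"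
  proof
    have "x $ i \<le> of_int k" if "x \<in> ?P" for x i
      using le[OF that, of i] \<delta>k2 k by auto
    then show "?P \<subseteq> {x. \<forall>i. 0 \<le> x $ i \<and> x $ i \<le> of_int k}" using Pnonneg by blast
    show "{x. \<forall>i. 0 \<le> x $ i \<and> x $ i \<le> of_int k} \<subseteq> ?P"
      using k corner by (subst cube_eq_convex_hull) (auto intro!: hull_mono)
  qed
  then show ?thesis using k by auto
qed

subsection \<open>The classification\<close>

text \<open>A maximal weighting with all loads at least \<open>k\<close> exists by
  \<open>max_load_covering\<close>, and its degree vector dominates every vector with entries 0 and
  \<open>k\<close>.\<close>

lemma cubes_in_\<D>:
  fixes E :: "'n::finite set set" and c :: "'n \<Rightarrow> nat"
  assumes "simple_graph E" "no_isolated_vertices E" "regular_graph E" "bipartite_graph E"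
    and "\<And>v. c v > 0" "\<And>v. k \<le> c v" and x: "\<And>i. x $ i = 0 \<or> x $ i = real k"
  shows "x \<in> \<D> TYPE('k::field) E c"
proof -
  obtain m where m: "m \<subseteq> E" "\<And>v. \<exists>!e. e \<in> m \<and> v \<in> e"
    using regular_bipartite_perfect_matching assms(2-4) by metis
  then have "E \<noteq> {}" by blast
  obtain w where "sum w E = max_load_size E c" "\<And>v. k \<le> load E w v" "\<And>v. load E w v \<le> c v"
    using max_load_covering[OF assms(1) m, of k c] assms(6) by metis
  moreover have "x = (\<chi> i. real (if x $ i = 0 then 0 else k))"
    using x by (auto simp: vec_eq_iff)
  ultimately show ?thesis
    unfolding \<D>_eq[OF assms(1) \<open>E \<noteq> {}\<close> allI[OF assms(5)]]
    by (intro CollectI exI[of _ "\<lambda>i. if x $ i = 0 then 0 else k"] exI[of _ w] conjI allI) auto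
qed

lemma \<D>_bounds:
  fixes E :: "'n::finite set set" and c :: "'n \<Rightarrow> nat"
  assumes "simple_graph E" "no_isolated_vertices E" "\<And>v. c v > 0" "x \<in> \<D> TYPE('k::field) E c"
  shows "0 \<le> x $ i" "x $ i \<le> real (c i)"
proof -
  have "E \<noteq> {}" using assms(2) by (auto simp: no_isolated_vertices_def)
  then obtain a w where "x = (\<chi> i. real (a i))" "\<forall>v. a v \<le> load E w v \<and> load E w v \<le> c v"
    using assms(4) unfolding \<D>_eq[OF assms(1) \<open>E \<noteq> {}\<close> allI[OF assms(3)]] by blast
  then show "0 \<le> x $ i" "x $ i \<le> real (c i)" by (auto intro: order_trans)
qed

text \<open>The constant bound \<open>k\<close> realizes the cube of side \<open>k\<close>: the
  bound confines the hull to the cube, and all corners of the cube are attained.\<close>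

lemma hull_\<D>_const:
  fixes E :: "'n::finite set set"
  assumes "simple_graph E" "no_isolated_vertices E" "regular_graph E" "bipartite_graph E" "k > 0"
  shows "convex hull (\<D> TYPE('k::field) E (\<lambda>_. k)) = {x. \<forall>i. 0 \<le> x $ i \<and> x $ i \<le> real k}"
proof
  have "convex {x :: real ^ 'n. \<forall>i. 0 \<le> x $ i \<and> x $ i \<le> real k}"
    using assms(5) by (simp add: cube_eq_convex_hull)
  then show "convex hull (\<D> TYPE('k) E (\<lambda>_. k)) \<subseteq> {x. \<forall>i. 0 \<le> x $ i \<and> x $ i \<le> real k}"
    using \<D>_bounds[OF assms(1,2), of "\<lambda>_. k"] assms(5) by (intro hull_minimal) blast+
  have "{x. \<forall>i. x $ i = 0 \<or> x $ i = real k} \<subseteq> \<D> TYPE('k) E (\<lambda>_. k)"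
    using cubes_in_\<D>[OF assms(1-4), of "\<lambda>_. k" k] assms(5) by blast
  then show "{x. \<forall>i. 0 \<le> x $ i \<and> x $ i \<le> real k} \<subseteq> convex hull (\<D> TYPE('k) E (\<lambda>_. k))"
    using assms(5) by (simp add: cube_eq_convex_hull hull_mono)
qed

lemma translated_centered_cube:
  "(\<lambda>x. x + (\<chi> i. 1)) ` centered_cube = {x :: real ^ 'n::finite. \<forall>i. 0 \<le> x $ i \<and> x $ i \<le> 2}"
proof -
  have "x \<in> (\<lambda>x. 2 *\<^sub>R x) ` unit_cube" if "\<forall>i. 0 \<le> x $ i \<and> x $ i \<le> 2" for x :: "real ^ 'n"
    using that by (intro image_eqI[of _ _ "(1 / 2) *\<^sub>R x"]) (auto simp: unit_cube_def)
  then show ?thesis by (auto simp: centered_cube_def image_image) (auto simp: unit_cube_def)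
qed

theorem theorem7p2:
  fixes E :: "'n::finite set set"
  assumes "CARD('n) \<ge> 3"
    and "simple_graph E"
    and "no_isolated_vertices E"
    and "connected_graph E"
    and "regular_graph E"
    and "bipartite_graph E"
  shows "{P. gorenstein_polytope P \<and>
            (\<exists>c :: 'n \<Rightarrow> nat. (\<forall>i. c i > 0) \<and> P = convex hull (\<D> TYPE('k::field) E c))}
         = {(\<lambda>x. x + (\<chi> i. 1)) ` centered_cube, unit_cube}"
proof -
  note G = assms(2,3,5,6)
  let ?cube = "\<lambda>k :: nat. {x :: real ^ 'n. \<forall>i. 0 \<le> x $ i \<and> x $ i \<le> real k}"
  have unit: "unit_cube = ?cube 1" by (simp add: unit_cube_def)
  have double: "(\<lambda>x. x + (\<chi> i. 1)) ` centered_cube = ?cube 2" by (simp add: translated_centered_cube)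
  have "convex hull (\<D> TYPE('k) E c) = ?cube 1 \<or> convex hull (\<D> TYPE('k) E c) = ?cube 2"
    if c: "\<forall>i. c i > 0" and gor: "gorenstein_polytope (convex hull (\<D> TYPE('k) E c))" for c
  proof -
    have bounds: "0 \<le> x $ i" "x $ i \<le> real (c i)" if "x \<in> \<D> TYPE('k) E c" for x i
      using \<D>_bounds[OF G(1,2)] c that by blast+
    have "x \<in> \<D> TYPE('k) E c" if "\<forall>i. x $ i = 0 \<or> x $ i = 1" for x
      using cubes_in_\<D>[OF G, of c 1 x] c that by (simp add: Suc_leI)
    moreover have "x \<in> \<D> TYPE('k) E c"
      if big: "\<forall>i. \<exists>v\<in>\<D> TYPE('k) E c. v $ i > 1" and x: "\<forall>i. x $ i = 0 \<or> x $ i = 2" for x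
    proof (rule cubes_in_\<D>[OF G, of c 2])
      \<comment> \<open>A coordinate above 1 occurs only if the integer bound \<open>c i\<close>
        exceeds 1.\<close>
      show "2 \<le> c i" for i
      proof -
        obtain v where "v \<in> \<D> TYPE('k) E c" "v $ i > 1" using big by blast
        then show ?thesis using bounds(2)[of v i] by linarith
      qed
    qed (use c x in auto)
    ultimately show ?thesis using gorenstein_hull_cases[OF gor] bounds(1) by simp
  qed
  \<comment> \<open>For the converse, the dilation factors are 2 for the unit cube and 1 for the
    cube of side 2.\<close>
  moreover have "gorenstein_polytope (?cube 1)" "gorenstein_polytope (?cube 2)"
    using gorenstein_cube[of 1 2] gorenstein_cube[of 2 1] by simp_all
  moreover have "?cube k = convex hull (\<D> TYPE('k) E (\<lambda>_. k))" if "k > 0" for k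
    using hull_\<D>_const[where 'k = 'k, OF G that] by (rule sym)
  then have "\<exists>c. (\<forall>i. c i > 0) \<and> ?cube k = convex hull (\<D> TYPE('k) E c)" if "k > 0" for k
    using that by (intro exI[of _ "\<lambda>_. k"]) simp
  then have "\<exists>c. (\<forall>i. c i > 0) \<and> ?cube 1 = convex hull (\<D> TYPE('k) E c)"
    "\<exists>c. (\<forall>i. c i > 0) \<and> ?cube 2 = convex hull (\<D> TYPE('k) E c)" by (simp_all only: zero_less_one zero_less_numeral)
  ultimately show ?thesis unfolding unit double by blast
qed

end
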